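(* Let $-\infty\le\tau<\sigma\le\infty$ and let $I$ be one of $(\tau,\sigma)$, $(\tau,\sigma]$, $[\tau,\sigma)$, $[\tau,\sigma]$ (an endpoint is included only if finite). Let $n\in\mathbb{N}$, let $\alpha,\beta,\gamma:I\to\mathbb{C}$ be continuous with $\alpha(t)\ne0$ for all $t\in I$, let $\bm{f}:I\to\mathbb{C}^n$ be continuous, and suppose there is a solution $\rho\in C^1(I,\mathbb{C})$ of $\alpha(t)(\rho'+\rho^2)+\beta(t)\rho+\gamma(t)=0$ on $I$. Define, for $t\in I$ (whenever the integrals exist), \[ f_1(t)=\int_t^\sigma\frac{e^{\int_t^s\Re\left(\rho(\mu)+\frac{\beta(\mu)}{\alpha(\mu)}\right)d\mu}}{|\alpha(s)|}ds,\qquad f_2(t)=\int_t^\sigma e^{-\int_t^s\Re(\rho(\mu))d\mu}ds, \] \[ f_3(t)=\int_\tau^t e^{\int_s^t\Re(\rho(\mu))d\mu}ds,\qquad f_4(t)=\int_\tau^t\frac{e^{-\int_s^t\Re\left(\rho(\mu)+\frac{\beta(\mu)}{\alpha(\mu)}\right)d\mu}}{|\alpha(s)|}ds. \] Consider the equation $(\ast)$: $\alpha(t)\bm{x}''+\beta(t)\bm{x}'+\gamma(t)\bm{x}=\bm{f}(t)$ on $I$. Then: (i) If $f_1,f_2$ exist on $I$ and $\sup_I f_1<\infty$, $\sup_I f_2<\infty$, then $(\ast)$ is Ulam stable on $I$ with Ulam constant \[ L_1=\sup_{t\in I}\int_t^\sigma\left(\int_s^\sigma\frac{e^{\int_s^\mu\Re\left(\rho(\nu)+\frac{\beta(\nu)}{\alpha(\nu)}\right)d\nu}}{|\alpha(\mu)|}d\mu\right)e^{-\int_t^s\Re(\rho(\mu))d\mu}ds.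 \] (ii) If $f_1,f_3$ exist on $I$ and $\sup_I f_1<\infty$, $\sup_I f_3<\infty$, then $(\ast)$ is Ulam stable on $I$ with Ulam constant \[ L_2=\sup_{t\in I}\int_\tau^t\left(\int_s^\sigma\frac{e^{\int_s^\mu\Re\left(\rho(\nu)+\frac{\beta(\nu)}{\alpha(\nu)}\right)d\nu}}{|\alpha(\mu)|}d\mu\right)e^{\int_s^t\Re(\rho(\mu))d\mu}ds. \] (iii) If $f_3,f_4$ exist on $I$ and $\sup_I f_3<\infty$, $\sup_I f_4<\infty$, then $(\ast)$ is Ulam stable on $I$ with Ulam constant \[ L_3=\sup_{t\in I}\int_\tau^t\left(\int_\tau^s\frac{e^{-\int_\mu^s\Re\left(\rho(\nu)+\frac{\beta(\nu)}{\alpha(\nu)}\right)d\nu}}{|\alpha(\mu)|}d\mu\right)e^{\int_s^t\Re(\rho(\mu))d\mu}ds. \]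
   Context: $\|\cdot\|$ is a norm on $\mathbb{C}^n$. Ulam stability: the equation $\alpha(t)\bm{x}''+\beta(t)\bm{x}'+\gamma(t)\bm{x}=\bm{f}(t)$ is Ulam stable on $I$ if there exists a constant $L>0$ such that for every $\varepsilon>0$ and every $\bm{\xi}\in C^2(I,\mathbb{C}^n)$ with $\sup_{t\in I}\|\alpha(t)\bm{\xi}''(t)+\beta(t)\bm{\xi}'(t)+\gamma(t)\bm{\xi}(t)-\bm{f}(t)\|\le\varepsilon$, there exists a solution $\bm{x}\in C^2(I,\mathbb{C}^n)$ of the equation with $\sup_{t\in I}\|\bm{\xi}(t)-\bm{x}(t)\|\le L\varepsilon$; such an $L$ is called an Ulam constant for the equation on $I$. $\Re(z)$ denotes the real part of $z\in\mathbb{C}$. *)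

theory Defs
  imports "HOL-Analysis.Analysis"
begin

definition is_cnorm :: "(complex^'n \<Rightarrow> real) \<Rightarrow> bool" where
  "is_cnorm N \<longleftrightarrow> (\<forall>x. 0 \<le> N x) \<and> (\<forall>x. N x = 0 \<longleftrightarrow> x = 0)
     \<and> (\<forall>c x. N (c *s x) = cmod c * N x) \<and> (\<forall>x y. N (x + y) \<le> N x + N y)"

definition C2_with :: "real set \<Rightarrow> (real \<Rightarrow> complex^'n) \<Rightarrow> (real \<Rightarrow> complex^'n)
    \<Rightarrow> (real \<Rightarrow> complex^'n) \<Rightarrow> bool" where
  "C2_with I x x' x'' \<longleftrightarrow>
     (\<forall>t\<in>I. (x has_vector_derivative x' t) (at t within I)) \<and>
     (\<forall>t\<in>I. (x' has_vector_derivative x'' t) (at t within I)) \<and>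
     continuous_on I x''"

definition ode_op :: "(real \<Rightarrow> complex) \<Rightarrow> (real \<Rightarrow> complex) \<Rightarrow> (real \<Rightarrow> complex)
    \<Rightarrow> (real \<Rightarrow> complex^'n) \<Rightarrow> (real \<Rightarrow> complex^'n) \<Rightarrow> (real \<Rightarrow> complex^'n)
    \<Rightarrow> real \<Rightarrow> complex^'n" where
  "ode_op \<alpha> \<beta> \<gamma> x x' x'' t = \<alpha> t *s x'' t + \<beta> t *s x' t + \<gamma> t *s x t"

definition ulam_constant :: "(complex^'n \<Rightarrow> real) \<Rightarrow> real set \<Rightarrow> (real \<Rightarrow> complex)
    \<Rightarrow> (real \<Rightarrow> complex) \<Rightarrow> (real \<Rightarrow> complex) \<Rightarrow> (real \<Rightarrow> complex^'n) \<Rightarrow> real \<Rightarrow> bool" where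
  "ulam_constant N I \<alpha> \<beta> \<gamma> f L \<longleftrightarrow> L > 0 \<and>
     (\<forall>\<epsilon>>0. \<forall>\<xi> \<xi>' \<xi>''. C2_with I \<xi> \<xi>' \<xi>'' \<and>
        (\<forall>t\<in>I. N (ode_op \<alpha> \<beta> \<gamma> \<xi> \<xi>' \<xi>'' t - f t) \<le> \<epsilon>) \<longrightarrow>
        (\<exists>x x' x''. C2_with I x x' x'' \<and> (\<forall>t\<in>I. ode_op \<alpha> \<beta> \<gamma> x x' x'' t = f t) \<and>
           (\<forall>t\<in>I. N (\<xi> t - x t) \<le> L * \<epsilon>)))"

definition ulam_stable :: "(complex^'n \<Rightarrow> real) \<Rightarrow> real set \<Rightarrow> (real \<Rightarrow> complex)
    \<Rightarrow> (real \<Rightarrow> complex) \<Rightarrow> (real \<Rightarrow> complex) \<Rightarrow> (real \<Rightarrow> complex^'n) \<Rightarrow> bool" where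
  "ulam_stable N I \<alpha> \<beta> \<gamma> f \<longleftrightarrow> (\<exists>L. ulam_constant N I \<alpha> \<beta> \<gamma> f L)"

definition to_right :: "ereal \<Rightarrow> real \<Rightarrow> real set" where
  "to_right \<sigma> t = {s. t \<le> s \<and> ereal s < \<sigma>}"
definition from_left :: "ereal \<Rightarrow> real \<Rightarrow> real set" where
  "from_left \<tau> t = {s. \<tau> < ereal s \<and> s \<le> t}"

definition wA :: "(real \<Rightarrow> complex) \<Rightarrow> (real \<Rightarrow> complex) \<Rightarrow> (real \<Rightarrow> complex) \<Rightarrow> real \<Rightarrow> real \<Rightarrow> real" where
  "wA \<alpha> \<beta> \<rho> a b = integral {a..b} (\<lambda>\<mu>. Re (\<rho> \<mu> + \<beta> \<mu> / \<alpha> \<mu>))"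
definition wR :: "(real \<Rightarrow> complex) \<Rightarrow> real \<Rightarrow> real \<Rightarrow> real" where
  "wR \<rho> a b = integral {a..b} (\<lambda>\<mu>. Re (\<rho> \<mu>))"

definition g1 where "g1 \<alpha> \<beta> \<rho> t s = exp (wA \<alpha> \<beta> \<rho> t s) / cmod (\<alpha> s)"
definition g2 where "g2 \<rho> t s = exp (- wR \<rho> t s)"
definition g3 where "g3 \<rho> t s = exp (wR \<rho> s t)"
definition g4 where "g4 \<alpha> \<beta> \<rho> t s = exp (- wA \<alpha> \<beta> \<rho> s t) / cmod (\<alpha> s)"

definition f1 where "f1 \<alpha> \<beta> \<rho> \<sigma> t = integral (to_right \<sigma> t) (g1 \<alpha> \<beta> \<rho> t)"
definition f2 where "f2 \<rho> \<sigma> t = integral (to_right \<sigma> t) (g2 \<rho> t)"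
definition f3 where "f3 \<rho> \<tau> t = integral (from_left \<tau> t) (g3 \<rho> t)"
definition f4 where "f4 \<alpha> \<beta> \<rho> \<tau> t = integral (from_left \<tau> t) (g4 \<alpha> \<beta> \<rho> t)"

end

(*
  If \<rho> solves the Riccati equation, then with p = \<rho> + \<beta> / \<alpha> the operator factors as
  \<alpha> x'' + \<beta> x' + \<gamma> x = \<alpha> (D + p) (D - \<rho>) x.  Given an approximate solution \<xi> with residual e,
  solve z' + p z = e / \<alpha> and then y' - \<rho> y = z by variation of constants, integrating each
  equation from the end of I at which its kernel is integrable.  The corrected function \<xi> - y
  is an exact solution, and N y is at most \<epsilon> times the iterated integral.  Both steps and
  both directions are instances of one formula, z t = \<plusminus> exp (- Q t) * (integral of exp (Q s) * h s
  over the part of I on the chosen side of t), for a primitive Q of the coefficient.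
*)
theory Submission
  imports Defs
begin

section \<open>Integrals of vector functions measured in an arbitrary norm\<close>

text \<open>Applied to the epigraph of an arbitrary norm, this replaces the library bound for the Euclidean norm
  of an integral.\<close>
lemma integral_in_closed_convex_cone:
  fixes g :: "'a::euclidean_space \<Rightarrow> 'b::euclidean_space"
  assumes S: "closed S" "convex S" "cone S" "S \<noteq> {}"
    and g: "g integrable_on A" "\<And>t. t \<in> A \<Longrightarrow> g t \<in> S"
  shows "integral A g \<in> S"
proof (rule ccontr)
  assume "integral A g \<notin> S"
  then obtain a b where ab: "a \<bullet> integral A g < b" "\<And>x. x \<in> S \<Longrightarrow> b < a \<bullet> x"
    using separating_hyperplane_closed_point[OF S(2,1)] by blast
  have "0 \<in> S"
    using S(3,4) cone_contains_0 by blast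
  then have "b < 0"
    using ab(2) by fastforce
  \<comment> \<open>If \<open>a \<bullet> x\<close> were negative, the positive multiple of
    \<open>x\<close> by \<open>b / (a \<bullet> x)\<close> would lie in the cone with inner product
    exactly \<open>b\<close>, against strict separation. So \<open>a \<bullet> g t\<close> is
    nonnegative, and this survives integration.\<close>
  have nonneg: "0 \<le> a \<bullet> x" if "x \<in> S" for x
  proof (rule ccontr)
    assume neg: "\<not> 0 \<le> a \<bullet> x"
    then have "(b / (a \<bullet> x)) *\<^sub>R x \<in> S"
      using \<open>b < 0\<close> that S(3) by (auto simp: cone_def zero_le_divide_iff)
    then show False
      using ab(2) neg by fastforce
  qed
  have "0 \<le> integral A (\<lambda>t. a \<bullet> g t)"
    using g nonneg by (intro integral_nonneg integrable_linear[OF g(1) bounded_linear_inner_right, unfolded o_def]) auto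
  also have "\<dots> = a \<bullet> integral A g"
    using integral_linear[OF g(1) bounded_linear_inner_right[of a]] by (simp add: o_def)
  finally show False
    using ab(1) \<open>b < 0\<close> by linarith
qed

lemma norm_scalar_mult_complex: "norm (c *s x) = cmod c * norm x" for x :: "complex^'n"
  by (simp add: norm_vec_def norm_mult L2_set_right_distrib)

lemma bounded_bilinear_scalar_mult_complex: "bounded_bilinear ((*s) :: complex \<Rightarrow> complex^'n \<Rightarrow> complex^'n)"
proof
  show "\<exists>K. \<forall>c (x::complex^'n). norm (c *s x) \<le> norm c * norm x * K"
    by (rule exI[of _ 1]) (simp add: norm_scalar_mult_complex)
qed (auto simp: vec_eq_iff algebra_simps)

lemmas continuous_on_smult [continuous_intros] =
  bounded_bilinear.continuous_on[OF bounded_bilinear_scalar_mult_complex]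

lemmas has_vector_derivative_smult =
  bounded_bilinear.has_vector_derivative[OF bounded_bilinear_scalar_mult_complex]

lemma scaleR_eq_smult: "r *\<^sub>R x = complex_of_real r *s x" for x :: "complex^'n"
  unfolding vec_eq_iff vector_scaleR_component vector_smult_component
  by (simp add: scaleR_conv_of_real)

context
  fixes N :: "complex^'n \<Rightarrow> real"
  assumes N: "is_cnorm N"
begin

lemma cnorm_nonneg: "0 \<le> N x"
  and cnorm_eq_0: "N x = 0 \<longleftrightarrow> x = 0"
  and cnorm_smult: "N (c *s x) = cmod c * N x"
  and cnorm_triangle: "N (x + y) \<le> N x + N y"
  using N by (auto simp: is_cnorm_def)

lemma cnorm_scaleR: "N (r *\<^sub>R x) = \<bar>r\<bar> * N x"
  by (simp add: scaleR_eq_smult cnorm_smult)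

lemma convex_on_cnorm: "convex_on UNIV N"
proof (rule convex_onI)
  fix t :: real and x y :: "complex^'n"
  assume "0 < t" "t < 1"
  then show "N ((1 - t) *\<^sub>R x + t *\<^sub>R y) \<le> (1 - t) * N x + t * N y"
    using cnorm_triangle[of "(1 - t) *\<^sub>R x" "t *\<^sub>R y"] by (simp add: cnorm_scaleR)
qed simp

text \<open>Convexity is the reason: a convex function on an open set of a finite-dimensional space
  is continuous.\<close>

lemma continuous_on_cnorm: "continuous_on A N"
  using convex_on_continuous[OF open_UNIV convex_on_cnorm] continuous_on_subset by blast

text \<open>One half of the equivalence of norms: \<open>N\<close> has a positive minimum on the
  compact Euclidean unit sphere, and homogeneity does the rest. It turns domination in
  \<open>N\<close> into Euclidean domination, from which integrability follows.\<close>

lemma norm_le_cnorm: obtains C where "C > 0" "\<And>x. norm x \<le> C * N x"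
proof -
  obtain x0 where x0: "norm x0 = 1" "\<And>x. norm x = 1 \<Longrightarrow> N x0 \<le> N x"
    using continuous_attains_inf[of "sphere 0 1" N] continuous_on_cnorm by auto
  have pos: "N x0 > 0"
    using x0(1) cnorm_nonneg[of x0] cnorm_eq_0[of x0] by force
  have "norm x \<le> inverse (N x0) * N x" for x
  proof (cases "x = 0")
    case True
    then show ?thesis by (simp add: cnorm_nonneg pos less_imp_le)
  next
    case False
    then have "N x0 \<le> N (x /\<^sub>R norm x)"
      by (intro x0(2)) simp
    then show ?thesis
      using False pos by (simp add: cnorm_scaleR field_simps)
  qed
  then show thesis
    using that[of "inverse (N x0)"] pos by simp
qed

text \<open>The pair \<open>(g t, h t)\<close> stays in the epigraph of \<open>N\<close>, a closed
  convex cone, so the pair of the two integrals lies there as well.\<close>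

lemma cnorm_integral_le:
  fixes g :: "'a::euclidean_space \<Rightarrow> complex^'n" and h :: "'a \<Rightarrow> real"
  assumes "g integrable_on A" "h integrable_on A" "\<And>t. t \<in> A \<Longrightarrow> N (g t) \<le> h t"
  shows "N (integral A g) \<le> integral A h"
proof -
  let ?S = "{p::(complex^'n) \<times> real. N (fst p) \<le> snd p}"
  have int: "((\<lambda>t. (g t, h t)) has_integral (integral A g, integral A h)) A"
    using has_integral_add[OF
        has_integral_linear[OF integrable_integral[OF assms(1)]
          bounded_linear_Pair[OF bounded_linear_ident bounded_linear_zero]]
        has_integral_linear[OF integrable_integral[OF assms(2)]
          bounded_linear_Pair[OF bounded_linear_zero bounded_linear_ident]]]
    by (simp add: o_def)
  have "integral A (\<lambda>t. (g t, h t)) \<in> ?S"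
  proof (rule integral_in_closed_convex_cone)
    show "closed ?S"
      by (intro closed_Collect_le continuous_intros
          continuous_on_compose2[OF continuous_on_cnorm[of UNIV] continuous_on_fst]) auto
    show "cone ?S"
      by (auto simp: cone_def cnorm_scaleR intro: mult_left_mono)
    show "convex ?S"
    proof (rule convexI, safe)
      fix x y :: "complex^'n" and r s u v :: real
      assume *: "N (fst (x, r)) \<le> snd (x, r)" "N (fst (y, s)) \<le> snd (y, s)" "0 \<le> u" "0 \<le> v"
      have "N (u *\<^sub>R x + v *\<^sub>R y) \<le> u * N x + v * N y"
        using cnorm_triangle[of "u *\<^sub>R x" "v *\<^sub>R y"] * by (simp add: cnorm_scaleR)
      also have "\<dots> \<le> u * r + v * s"
        using * by (intro add_mono mult_left_mono) auto
      finally show "N (fst (u *\<^sub>R (x, r) + v *\<^sub>R (y, s))) \<le> snd (u *\<^sub>R (x, r) + v *\<^sub>R (y, s))"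
        by simp
    qed
    have "(0, 0) \<in> ?S"
      using cnorm_eq_0[of 0] by simp
    then show "?S \<noteq> {}"
      by blast
    show "(\<lambda>t. (g t, h t)) integrable_on A"
      using int by blast
    show "(g t, h t) \<in> ?S" if "t \<in> A" for t
      using assms(3)[OF that] by simp
  qed
  with int show ?thesis
    by (simp add: integral_unique)
qed

end

section \<open>Primitives on intervals with open, closed or infinite ends\<close>

text \<open>Differentiability is local, so the fundamental theorem on a compact interval around
  \<open>t\<close> suffices. Speaking of increments only, the statement also covers integrals that
  start at an infinite or excluded end.\<close>

lemma has_vector_derivative_of_increments:
  fixes W G :: "real \<Rightarrow> 'a::banach"
  assumes I: "is_interval I" and G: "continuous_on I G" and t: "t \<in> I"
    and incr: "\<And>a b. a \<in> I \<Longrightarrow> b \<in> I \<Longrightarrow> a \<le> b \<Longrightarrow> W b - W a = integral {a..b} G"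
  shows "(W has_vector_derivative G t) (at t within I)"
proof -
  \<comment> \<open>\<open>a\<close> lies strictly left of \<open>t\<close> unless \<open>t\<close>
    is the left end of \<open>I\<close>, in which case \<open>a = t\<close>; \<open>b\<close> is
    chosen likewise on the right. Thus \<open>{a..b}\<close> is a neighbourhood of \<open>t\<close>
    relative to \<open>I\<close>.\<close>
  obtain a where a: "a \<in> I" "a \<le> t" "a = t \<longrightarrow> (\<forall>s\<in>I. t \<le> s)"
  proof (cases "\<exists>s\<in>I. s < t")
    case True
    then show thesis using that by (metis less_imp_le less_irrefl)
  next
    case False
    then show thesis using that[of t] t by (simp add: not_less)
  qed
  obtain b where b: "b \<in> I" "t \<le> b" "b = t \<longrightarrow> (\<forall>s\<in>I. s \<le> t)"
  proof (cases "\<exists>s\<in>I. t < s")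
    case True
    then show thesis using that by (metis less_imp_le less_irrefl)
  next
    case False
    then show thesis using that[of t] t by (simp add: not_less)
  qed
  \<comment> \<open>If \<open>a = t\<close> or \<open>b = t\<close>, no point of \<open>I\<close>
    lies beyond \<open>t\<close> on that side, so widening by 1 adds nothing of
    \<open>I\<close>.\<close>
  define U where "U = {(if a = t then t - 1 else a)<..<(if b = t then t + 1 else b)}"
  have sub: "{a..b} \<subseteq> I"
    using mem_is_interval_1_I[OF I a(1) b(1)] by auto
  have "at t within I = at t within {a..b}"
  proof (rule at_within_nhd)
    show "open U" "t \<in> U"
      using a b by (auto simp: U_def)
    show "I \<inter> U - {t} = {a..b} \<inter> U - {t}"
    proof (intro equalityI subsetI)
      fix s assume s: "s \<in> I \<inter> U - {t}"
      then have "a \<le> s" "s \<le> b"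
        using a(3) b(3) by (auto simp: U_def split: if_splits)
      with s show "s \<in> {a..b} \<inter> U - {t}" by auto
    qed (use sub in auto)
  qed
  moreover have "((\<lambda>u. W a + integral {a..u} G) has_vector_derivative G t) (at t within {a..b})"
    using has_vector_derivative_add[OF has_vector_derivative_const
        integral_has_vector_derivative[OF continuous_on_subset[OF G sub], of t]] a b
    by simp
  moreover have "W a + integral {a..u} G = W u" if "u \<in> {a..b}" for u
    using incr[of a u] that a(1) sub by (auto simp: algebra_simps subset_iff)
  ultimately show ?thesis
    using has_vector_derivative_transform[of t "{a..b}" W "\<lambda>u. W a + integral {a..u} G"] a b by simp
qed

text \<open>The increment property is what later turns the exponents \<open>wA\<close> and
  \<open>wR\<close> into differences of primitives.\<close>

lemma continuous_on_antiderivative: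
  fixes q :: "real \<Rightarrow> 'a::banach"
  assumes I: "is_interval I" and q: "continuous_on I q"
  obtains Q where "\<And>t. t \<in> I \<Longrightarrow> (Q has_vector_derivative q t) (at t within I)"
    and "\<And>a b. a \<in> I \<Longrightarrow> b \<in> I \<Longrightarrow> a \<le> b \<Longrightarrow> Q b - Q a = integral {a..b} q"
proof (cases "I = {}")
  case False
  then obtain c where c: "c \<in> I" by auto
  define Q where "Q t = (if c \<le> t then integral {c..t} q else - integral {t..c} q)" for t
  have int: "q integrable_on {a..b}" if "a \<in> I" "b \<in> I" for a b
    using mem_is_interval_1_I[OF I that]
    by (intro integrable_continuous_real continuous_on_subset[OF q]) auto
  have incr: "Q b - Q a = integral {a..b} q" if "a \<in> I" "b \<in> I" "a \<le> b" for a b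
  proof -
    note combine = Henstock_Kurzweil_Integration.integral_combine[OF _ _ int]
    consider "c \<le> a" | "a < c" "c \<le> b" | "b < c" by linarith
    then show ?thesis
    proof cases
      case 1
      then show ?thesis using combine[of c a b] that c by (simp add: Q_def algebra_simps)
    next
      case 2
      then show ?thesis using combine[of a c b] that c by (simp add: Q_def algebra_simps)
    next
      case 3
      then show ?thesis using combine[of a b c] that c by (simp add: Q_def algebra_simps)
    qed
  qed
  with that has_vector_derivative_of_increments[OF I q] show thesis
    by blast
qed auto

text \<open>Slack by negligible sets is wanted because adjacent pieces share an endpoint, and
  because tails leave out the end of \<open>I\<close> even when it belongs to
  \<open>I\<close>.\<close>

lemma integral_almost_Un:
  fixes G :: "'a::euclidean_space \<Rightarrow> 'b::banach"
  assumes "G integrable_on S" "G integrable_on T" "negligible (S \<inter> T)"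
    and "negligible (U - (S \<union> T))" "negligible ((S \<union> T) - U)"
  shows "integral U G = integral S G + integral T G"
proof -
  have "(G has_integral (integral S G + integral T G)) (S \<union> T)"
    using assms by (intro has_integral_Un integrable_integral)
  then have "(G has_integral (integral S G + integral T G)) U"
    using has_integral_spike_set_eq[of U "S \<union> T" G,
        OF negligible_subset[OF assms(4)] negligible_subset[OF assms(5)]] by blast
  then show ?thesis by (rule integral_unique)
qed

lemma has_vector_derivative_exp_within:
  fixes Q :: "real \<Rightarrow> complex"
  assumes "(Q has_vector_derivative q) (at t within I)"
  shows "((\<lambda>t. exp (Q t)) has_vector_derivative q * exp (Q t)) (at t within I)"
  using field_vector_diff_chain_within[OF assms has_field_derivative_at_within[OF DERIV_exp]]
  by (simp add: o_def)

lemma continuous_on_of_has_vector_derivative: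
  assumes "\<And>t. t \<in> I \<Longrightarrow> (Q has_vector_derivative q t) (at t within I)"
  shows "continuous_on I Q"
  unfolding continuous_on_eq_continuous_within
  using assms has_vector_derivative_continuous by blast

section \<open>Integrals from a point to one end of the interval\<close>

text \<open>The two inclusions capture all four kinds of interval at once; an infinite end cannot
  belong to \<open>I\<close>, a set of reals.\<close>

locale ereal_interval =
  fixes \<tau> \<sigma> :: ereal and I :: "real set"
  assumes ends_less: "\<tau> < \<sigma>"
    and open_subset: "{x. \<tau> < ereal x \<and> ereal x < \<sigma>} \<subseteq> I"
    and subset_closed: "I \<subseteq> {x. \<tau> \<le> ereal x \<and> ereal x \<le> \<sigma>}"
begin

lemma mem_I: "\<tau> < ereal x \<Longrightarrow> ereal x < \<sigma> \<Longrightarrow> x \<in> I"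
  using open_subset by blast

lemma above_left: "\<tau> < ereal s" if "t \<in> I" "t < s"
proof -
  have "\<tau> \<le> ereal t" using subset_closed that by blast
  also have "ereal t < ereal s" using that by simp
  finally show ?thesis .
qed

lemma below_right: "ereal s < \<sigma>" if "t \<in> I" "s < t"
proof -
  have "ereal s < ereal t" using that by simp
  also have "ereal t \<le> \<sigma>" using subset_closed that by blast
  finally show ?thesis .
qed

lemma is_interval_I: "is_interval I"
  unfolding is_interval_1
proof safe
  fix a b x assume "a \<in> I" "b \<in> I" "a \<le> x" "x \<le> b"
  then show "x \<in> I"
    using mem_I[of x] above_left[of a x] below_right[of b x] by (metis order_le_less)
qed

text \<open>\<open>\<delta>\<close> is the sign with which the integrand appears when an integral
  over \<open>J t\<close> is differentiated in \<open>t\<close>. Carrying it along lets both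
  directions share every later argument.\<close>

definition tail :: "(real \<Rightarrow> real set) \<Rightarrow> real \<Rightarrow> bool" where
  "tail J \<delta> \<longleftrightarrow> J = to_right \<sigma> \<and> \<delta> = -1 \<or> J = from_left \<tau> \<and> \<delta> = 1"

lemma tail_cases:
  assumes "tail J \<delta>"
  obtains (right) "J = to_right \<sigma>" "\<delta> = -1" | (left) "J = from_left \<tau>" "\<delta> = 1"
  using assms by (auto simp: tail_def)

lemma tail_subset: "J t \<subseteq> I" if "tail J \<delta>" "t \<in> I"
  using that(1)
proof (cases rule: tail_cases)
  case right
  then show ?thesis
    using mem_I above_left[OF that(2)] that(2) by (force simp: to_right_def order_le_less)
next
  case left
  then show ?thesis
    using mem_I below_right[OF that(2)] that(2) by (force simp: from_left_def order_le_less)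
qed

lemma tail_sets: "J t \<in> sets lebesgue" if "tail J \<delta>"
  using that
proof (cases rule: tail_cases)
  case right
  have "to_right \<sigma> t = {} \<or> to_right \<sigma> t = {t..} \<or> (\<exists>r. to_right \<sigma> t = {t..<r})"
    by (cases \<sigma>) (auto simp: to_right_def)
  with right show ?thesis by auto
next
  case left
  have "from_left \<tau> t = {} \<or> from_left \<tau> t = {..t} \<or> (\<exists>r. from_left \<tau> t = {r<..t})"
    by (cases \<tau>) (auto simp: from_left_def)
  with left show ?thesis by auto
qed

text \<open>As the base point moves from \<open>a\<close> to \<open>b\<close>, a right tail loses
  \<open>{a..b}\<close> and a left tail gains it, up to single points.\<close>

lemma tail_increment:
  fixes G :: "real \<Rightarrow> 'a::banach"
  assumes J: "tail J \<delta>" and G: "continuous_on I G" "\<And>t. t \<in> I \<Longrightarrow> G integrable_on J t"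
    and ab: "a \<in> I" "b \<in> I" "a \<le> b"
  shows "integral (J b) G - integral (J a) G = \<delta> *\<^sub>R integral {a..b} G"
proof -
  have int: "G integrable_on {a..b}"
    using mem_is_interval_1_I[OF is_interval_I ab(1,2)]
    by (intro integrable_continuous_real continuous_on_subset[OF G(1)]) auto
  show ?thesis
    using J
  proof (cases rule: tail_cases)
    case right
    have "integral (J a) G = integral {a..b} G + integral (J b) G"
    proof (rule integral_almost_Un[OF int G(2)[OF ab(2)]])
      show "negligible ({a..b} \<inter> J b)"
        by (rule negligible_subset[of "{b}"]) (auto simp: right to_right_def)
      show "negligible (J a - ({a..b} \<union> J b))"
        by (rule negligible_subset[of "{b}"]) (auto simp: right to_right_def)
      \<comment> \<open>The exceptional point is \<open>b\<close>, which may be the end \<sigma>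
        itself and then is missing from \<open>to_right\<close>.\<close>
      show "negligible ({a..b} \<union> J b - J a)"
      proof (rule negligible_subset[of "{b}"], simp, rule subsetI)
        fix s assume "s \<in> {a..b} \<union> J b - J a"
        then show "s \<in> {b}"
          using below_right[OF ab(2), of s] ab(3) by (cases "s < b") (auto simp: right to_right_def)
      qed
    qed
    with right show ?thesis by simp
  next
    case left
    have "integral (J b) G = integral {a..b} G + integral (J a) G"
    proof (rule integral_almost_Un[OF int G(2)[OF ab(1)]])
      show "negligible ({a..b} \<inter> J a)"
        by (rule negligible_subset[of "{a}"]) (auto simp: left from_left_def)
      show "negligible (J b - ({a..b} \<union> J a))"
        by (rule negligible_subset[of "{a}"]) (auto simp: left from_left_def)
      show "negligible ({a..b} \<union> J a - J b)"
      proof (rule negligible_subset[of "{a}"], simp, rule subsetI)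
        fix s assume "s \<in> {a..b} \<union> J a - J b"
        then show "s \<in> {a}"
          using above_left[OF ab(1), of s] ab(3) by (cases "a < s") (auto simp: left from_left_def)
      qed
    qed
    with left show ?thesis by simp
  qed
qed

lemma tail_integral_has_vector_derivative:
  fixes G :: "real \<Rightarrow> 'a::banach"
  assumes "tail J \<delta>" "continuous_on I G" "\<And>t. t \<in> I \<Longrightarrow> G integrable_on J t" "t \<in> I"
  shows "((\<lambda>t. integral (J t) G) has_vector_derivative \<delta> *\<^sub>R G t) (at t within I)"
  using assms(4)
proof (rule has_vector_derivative_of_increments[OF is_interval_I, rotated])
  show "continuous_on I (\<lambda>t. \<delta> *\<^sub>R G t)"
    using assms(2) by (intro continuous_intros)
qed (use tail_increment[OF assms(1-3)] in simp)

text \<open>Serves to show that the Ulam constant is positive. Strict positivity is asked only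
  strictly between the ends, since at an included end the tail may be empty and an integral over it
  zero.\<close>

lemma tail_integral_pos:
  fixes G :: "real \<Rightarrow> real"
  assumes J: "tail J \<delta>" and G: "continuous_on I G" "G integrable_on J t" "\<And>s. s \<in> I \<Longrightarrow> 0 \<le> G s"
    and pos: "\<And>s. \<tau> < ereal s \<Longrightarrow> ereal s < \<sigma> \<Longrightarrow> 0 < G s"
    and t: "\<tau> < ereal t" "ereal t < \<sigma>"
  shows "integral (J t) G > 0"
proof -
  have tI: "t \<in> I" using t by (rule mem_I)
  obtain a b where ab: "a < b" "{a..b} \<subseteq> J t"
    using J
  proof (cases rule: tail_cases)
    case right
    obtain b where "ereal t < ereal b" "ereal b < \<sigma>"
      using ereal_dense2[OF t(2)] by blast
    then have "t < b" and *: "\<And>s. s \<le> b \<Longrightarrow> ereal s < \<sigma>"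
      using le_less_trans[of "ereal _" "ereal b" \<sigma>] by auto
    then show thesis
      using that[of t b] * by (auto simp: subset_iff right to_right_def)
  next
    case left
    obtain a where "\<tau> < ereal a" "ereal a < ereal t"
      using ereal_dense2[OF t(1)] by blast
    then have "a < t" and *: "\<And>s. a \<le> s \<Longrightarrow> \<tau> < ereal s"
      using less_le_trans[of \<tau> "ereal a" "ereal _"] by auto
    then show thesis
      using that[of a t] * by (auto simp: subset_iff left from_left_def)
  qed
  have sub: "{a..b} \<subseteq> I"
    using ab(2) tail_subset[OF J tI] by blast
  have cont: "continuous_on {a..b} G"
    using G(1) sub by (rule continuous_on_subset)
  have "0 < integral {a..b} G"
  proof -
    have "integral {a..b} (\<lambda>_. 0) < integral {a..b} G"
    proof (rule integral_less_real)
      show "0 < G s" if "s \<in> {a<..<b}" for s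
        using that sub ab(1) by (intro pos above_left[of a] below_right[of b]) auto
    qed (use cont ab(1) in auto)
    then show ?thesis by simp
  qed
  also have "\<dots> \<le> integral (J t) G"
  proof (rule integral_subset_le[OF ab(2) integrable_continuous_real[OF cont] G(2)])
    show "\<forall>s\<in>J t. 0 \<le> G s"
      using tail_subset[OF J tI] G(3) by auto
  qed
  finally show ?thesis .
qed

section \<open>First-order equations by variation of constants\<close>

text \<open>The constant \<open>K\<close> is kept apart from the profile \<open>H\<close> so that
  the bound on one solution can feed the next application. The integral is the whole of
  \<open>z\<close>, with no homogeneous part, so the bound carries no initial value.\<close>

lemma first_order_tail_solution:
  fixes h :: "real \<Rightarrow> complex^'n" and Q q :: "real \<Rightarrow> complex" and H :: "real \<Rightarrow> real"
  assumes J: "tail J \<delta>" and N: "is_cnorm N" and h: "continuous_on I h"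
    and Q: "\<And>t. t \<in> I \<Longrightarrow> (Q has_vector_derivative q t) (at t within I)"
    and H: "\<And>t. t \<in> I \<Longrightarrow> (\<lambda>s. exp (Re (Q s - Q t)) * H s) integrable_on J t"
    and le: "\<And>s. s \<in> I \<Longrightarrow> N (h s) \<le> K * H s"
  obtains z where "\<And>t. t \<in> I \<Longrightarrow> (z has_vector_derivative h t - q t *s z t) (at t within I)"
    and "\<And>t. t \<in> I \<Longrightarrow> N (z t) \<le> K * integral (J t) (\<lambda>s. exp (Re (Q s - Q t)) * H s)"
proof
  define G where "G s = exp (Q s) *s h s" for s
  define z where "z t = (of_real \<delta> * exp (- Q t)) *s integral (J t) G" for t
  have \<delta>: "\<delta> * \<delta> = 1" "\<bar>\<delta>\<bar> = 1"
    using J by (auto simp: tail_def)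
  have contG: "continuous_on I G"
    unfolding G_def using continuous_on_of_has_vector_derivative[OF Q] h
    by (intro continuous_intros)
  \<comment> \<open>For fixed \<open>t\<close> the factor \<open>exp (Re (Q t))\<close> is constant
    in \<open>s\<close>, so the assumed integrability at \<open>t\<close> yields a dominating
    function for \<open>G\<close>.\<close>
  have NG: "N (G s) \<le> (K * exp (Re (Q t))) * (exp (Re (Q s - Q t)) * H s)" if "s \<in> I" for s t
  proof -
    have "N (G s) = exp (Re (Q s)) * N (h s)"
      by (simp add: G_def cnorm_smult[OF N])
    also have "\<dots> \<le> exp (Re (Q s)) * (K * H s)"
      using le[OF that] by (intro mult_left_mono) auto
    also have "\<dots> = (K * exp (Re (Q t))) * (exp (Re (Q s - Q t)) * H s)"
      by (simp add: exp_diff)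
    finally show ?thesis .
  qed
  have bound_int: "(\<lambda>s. (K * exp (Re (Q t))) * (exp (Re (Q s - Q t)) * H s)) integrable_on J t"
    if "t \<in> I" for t
    using H[OF that] by (rule integrable_on_mult_right)
  have Gint: "G integrable_on J t" if t: "t \<in> I" for t
  proof -
    obtain C where C: "C > 0" "\<And>x. norm x \<le> C * N x"
      using norm_le_cnorm[OF N] by blast
    show ?thesis
    proof (rule measurable_bounded_by_integrable_imp_integrable)
      show "G \<in> borel_measurable (lebesgue_on (J t))"
        using continuous_on_subset[OF contG tail_subset[OF J t]] tail_sets[OF J]
        by (rule continuous_imp_measurable_on_sets_lebesgue)
      show "(\<lambda>s. C * ((K * exp (Re (Q t))) * (exp (Re (Q s - Q t)) * H s))) integrable_on J t"
        using bound_int[OF t] by (rule integrable_on_mult_right)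
      fix s assume "s \<in> J t"
      then have "s \<in> I" using tail_subset[OF J t] by blast
      then show "norm (G s) \<le> C * ((K * exp (Re (Q t))) * (exp (Re (Q s - Q t)) * H s))"
        using C(2)[of "G s"] mult_left_mono[OF NG[of s t] less_imp_le[OF C(1)]] by linarith
    qed (rule tail_sets[OF J])
  qed
  show "(z has_vector_derivative h t - q t *s z t) (at t within I)" if t: "t \<in> I" for t
  proof -
    have "((\<lambda>t. exp (- Q t)) has_vector_derivative - q t * exp (- Q t)) (at t within I)"
      using has_vector_derivative_exp_within[OF has_vector_derivative_minus[OF Q[OF t]]] .
    then have E: "((\<lambda>t. of_real \<delta> * exp (- Q t)) has_vector_derivative
        of_real \<delta> * (- q t * exp (- Q t))) (at t within I)"
      by (rule has_vector_derivative_mult_right)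
    \<comment> \<open>The two summands of the product rule: the sign of the prefactor and the sign
      from the tail cancel as \<open>\<delta> * \<delta> = 1\<close>, leaving \<open>h t\<close>;
      differentiating the exponential gives the other term.\<close>
    have "(of_real \<delta> * exp (- Q t)) *s (\<delta> *\<^sub>R G t) + (of_real \<delta> * (- q t * exp (- Q t))) *s integral (J t) G
        = h t - q t *s z t"
    proof -
      have "of_real \<delta> * of_real \<delta> = (1::complex)"
        using \<delta>(1) by (metis of_real_1 of_real_mult)
      then have "(of_real \<delta> * exp (- Q t)) * (of_real \<delta> * exp (Q t)) = (1::complex)"
        by (simp add: exp_minus field_simps)
      then have "(of_real \<delta> * exp (- Q t)) *s (\<delta> *\<^sub>R G t) = h t"
        by (simp add: G_def scaleR_eq_smult mult.assoc)
      then show ?thesis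
        by (simp add: z_def vec_eq_iff)
    qed
    with has_vector_derivative_smult[OF E tail_integral_has_vector_derivative[OF J contG Gint t]]
    show ?thesis
      unfolding z_def[abs_def] by simp
  qed
  show "N (z t) \<le> K * integral (J t) (\<lambda>s. exp (Re (Q s - Q t)) * H s)" if t: "t \<in> I" for t
  proof -
    have "N (z t) = exp (- Re (Q t)) * N (integral (J t) G)"
      by (simp add: z_def cnorm_smult[OF N] norm_mult \<delta>)
    also have "\<dots> \<le> exp (- Re (Q t)) *
        integral (J t) (\<lambda>s. (K * exp (Re (Q t))) * (exp (Re (Q s - Q t)) * H s))"
      using tail_subset[OF J t]
      by (intro mult_left_mono cnorm_integral_le[OF N Gint[OF t] bound_int[OF t]] NG) auto
    also have "\<dots> = K * integral (J t) (\<lambda>s. exp (Re (Q s - Q t)) * H s)"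
      by (simp add: exp_minus)
    finally show ?thesis .
  qed
qed

section \<open>The factored second-order equation and its Ulam constant\<close>

text \<open>\<open>J1\<close> and \<open>w1\<close> belong to the factor \<open>D + p\<close>,
  \<open>J2\<close> and \<open>w2\<close> to \<open>D - \<rho>\<close>. The weights are prescribed
  only on the tails, where the kernels for either direction take the same form; this makes the three
  cases instances of one statement.\<close>

lemma ulam_constant_tails:
  fixes N :: "complex^'n \<Rightarrow> real" and \<alpha> \<beta> \<gamma> \<rho> \<rho>' P R :: "real \<Rightarrow> complex"
    and f :: "real \<Rightarrow> complex^'n" and w1 w2 :: "real \<Rightarrow> real \<Rightarrow> real"
  assumes N: "is_cnorm N"
    and cont: "continuous_on I \<alpha>" "continuous_on I \<beta>" "continuous_on I \<gamma>" "continuous_on I f"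
    and nonzero: "\<forall>t\<in>I. \<alpha> t \<noteq> 0"
    and deriv: "\<forall>t\<in>I. (\<rho> has_vector_derivative \<rho>' t) (at t within I)" "continuous_on I \<rho>'"
    and riccati: "\<forall>t\<in>I. \<alpha> t * (\<rho>' t + (\<rho> t)\<^sup>2) + \<beta> t * \<rho> t + \<gamma> t = 0"
    and P_deriv: "\<forall>t\<in>I. (P has_vector_derivative \<rho> t + \<beta> t / \<alpha> t) (at t within I)"
    and R_deriv: "\<forall>t\<in>I. (R has_vector_derivative \<rho> t) (at t within I)"
    and J1: "tail J1 \<delta>1" and J2: "tail J2 \<delta>2"
    and w1_eq: "\<And>t s. t \<in> I \<Longrightarrow> s \<in> J1 t \<Longrightarrow> w1 t s = exp (Re (P s - P t)) / cmod (\<alpha> s)"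
    and w2_eq: "\<And>t s. t \<in> I \<Longrightarrow> s \<in> J2 t \<Longrightarrow> w2 t s = exp (Re (R t - R s))"
    and w1_int: "\<And>t. t \<in> I \<Longrightarrow> w1 t integrable_on J1 t"
    and w2_int: "\<And>t. t \<in> I \<Longrightarrow> w2 t integrable_on J2 t"
    and bdd1: "bdd_above ((\<lambda>t. integral (J1 t) (w1 t)) ` I)"
    and bdd2: "bdd_above ((\<lambda>t. integral (J2 t) (w2 t)) ` I)"
  shows "ulam_constant N I \<alpha> \<beta> \<gamma> f (SUP t\<in>I. integral (J2 t) (\<lambda>s. integral (J1 s) (w1 s) * w2 t s))"
proof -
  note \<alpha> = bspec[OF nonzero] and \<rho> = bspec[OF deriv(1)] deriv(2)
    and P = bspec[OF P_deriv] and R = bspec[OF R_deriv]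
  define k where "k t = integral (J1 t) (w1 t)" for t
  define B where "B t = integral (J2 t) (\<lambda>s. k s * w2 t s)" for t
  obtain M1 where M1: "\<And>t. t \<in> I \<Longrightarrow> k t \<le> M1"
    using bdd1 by (auto simp: bdd_above_def k_def)
  obtain M2 where M2: "\<And>t. t \<in> I \<Longrightarrow> integral (J2 t) (w2 t) \<le> M2"
    using bdd2 by (auto simp: bdd_above_def)
  note contP = continuous_on_of_has_vector_derivative[OF P]
    and contR = continuous_on_of_has_vector_derivative[OF R]
    and cont\<rho> = continuous_on_of_has_vector_derivative[OF \<rho>(1)]
  \<comment> \<open>Multiplying by \<open>exp (Re (P t))\<close> removes \<open>t\<close> from the
    integrand, so \<open>k\<close> is an exponential times a tail integral of one fixed function.
    Continuity and positivity of \<open>k\<close> come from this.\<close>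
  define G where "G s = exp (Re (P s)) / cmod (\<alpha> s)" for s
  have G_w1: "exp (Re (P t)) * w1 t s = G s" if "t \<in> I" "s \<in> J1 t" for t s
    using w1_eq[OF that] by (simp add: G_def exp_diff)
  have contG: "continuous_on I G"
    unfolding G_def using cont(1) \<alpha> contP by (intro continuous_intros) auto
  have Gint: "G integrable_on J1 t" if "t \<in> I" for t
    using integrable_eq[OF integrable_on_mult_right[OF w1_int[OF that]] G_w1[OF that]] .
  have k_G: "k t = exp (- Re (P t)) * integral (J1 t) G" if "t \<in> I" for t
  proof -
    have "integral (J1 t) G = integral (J1 t) (\<lambda>s. exp (Re (P t)) * w1 t s)"
      using G_w1[OF that] by (intro integral_cong) simp
    then show ?thesis
      by (simp add: k_def exp_minus)
  qed
  have k_pos: "0 < k t" if "\<tau> < ereal t" "ereal t < \<sigma>" for t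
  proof -
    have "0 < integral (J1 t) G"
      using that Gint[OF mem_I] \<alpha>[OF mem_I]
      by (intro tail_integral_pos[OF J1 contG]) (auto simp: G_def)
    then show ?thesis
      by (simp add: k_G[OF mem_I[OF that]])
  qed
  have k_nonneg: "0 \<le> k t" if "t \<in> I" for t
    unfolding k_def using w1_int[OF that] w1_eq[OF that] by (intro integral_nonneg) auto
  have cont_k: "continuous_on I k"
  proof (rule continuous_on_eq)
    show "continuous_on I (\<lambda>t. exp (- Re (P t)) * integral (J1 t) G)"
      using contP continuous_on_of_has_vector_derivative[OF
          tail_integral_has_vector_derivative[OF J1 contG Gint]]
      by (intro continuous_intros)
  qed (simp add: k_G)
  \<comment> \<open>Boundedness of \<open>k\<close> enters here: \<open>M1 * w2 t s\<close>
    dominates, and continuity supplies measurability.\<close>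
  have kw_int: "(\<lambda>s. k s * w2 t s) integrable_on J2 t" if t: "t \<in> I" for t
  proof (rule measurable_bounded_by_integrable_imp_integrable)
    have "continuous_on (J2 t) (\<lambda>s. k s * exp (Re (R t - R s)))"
      using continuous_on_subset[OF cont_k tail_subset[OF J2 t]]
        continuous_on_subset[OF contR tail_subset[OF J2 t]]
      by (intro continuous_intros)
    then have "continuous_on (J2 t) (\<lambda>s. k s * w2 t s)"
      by (rule continuous_on_eq) (simp add: w2_eq[OF t])
    then show "(\<lambda>s. k s * w2 t s) \<in> borel_measurable (lebesgue_on (J2 t))"
      using tail_sets[OF J2] by (rule continuous_imp_measurable_on_sets_lebesgue)
    show "(\<lambda>s. M1 * w2 t s) integrable_on J2 t"
      using w2_int[OF t] by (rule integrable_on_mult_right)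
    fix s assume s: "s \<in> J2 t"
    then have "s \<in> I" using tail_subset[OF J2 t] by blast
    with s show "norm (k s * w2 t s) \<le> M1 * w2 t s"
      using M1 k_nonneg w2_eq[OF t s] by (simp add: abs_mult)
  qed (rule tail_sets[OF J2])
  \<comment> \<open>A finite bound makes the supremum a genuine upper bound of \<open>B\<close>.
    With \<open>max 0 M1\<close> the factor in front of \<open>M2\<close> is visibly
    nonnegative.\<close>
  have B_le: "B t \<le> max 0 M1 * M2" if t: "t \<in> I" for t
  proof -
    have "B t \<le> integral (J2 t) (\<lambda>s. max 0 M1 * w2 t s)"
      unfolding B_def using kw_int[OF t] integrable_on_mult_right[OF w2_int[OF t]]
    proof (rule integral_le)
      fix s assume s: "s \<in> J2 t"
      then have "s \<in> I" using tail_subset[OF J2 t] by blast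
      then have "k s \<le> max 0 M1" using M1 by (simp add: le_max_iff_disj)
      then show "k s * w2 t s \<le> max 0 M1 * w2 t s"
        using w2_eq[OF t s] by (intro mult_right_mono) auto
    qed
    also have "\<dots> \<le> max 0 M1 * M2"
      using M2[OF t] by (simp add: mult_left_mono)
    finally show ?thesis .
  qed
  have bddB: "bdd_above (B ` I)"
    using B_le by (intro bdd_aboveI2)
  have B_le_Sup: "B t \<le> (SUP t\<in>I. B t)" if "t \<in> I" for t
    using that bddB by (rule cSUP_upper)
  \<comment> \<open>The second equation has coefficient \<open>- \<rho>\<close>, hence primitive
    \<open>- R\<close>; the double minus matches the shape of the first-order lemma with profile
    \<open>k\<close>.\<close>
  have R_int: "(\<lambda>s. exp (Re (- R s - - R t)) * k s) integrable_on J2 t" if "t \<in> I" for t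
    using w2_eq[OF that] by (intro integrable_eq[OF kw_int[OF that]]) (simp add: ac_simps)
  have B_eq: "B t = integral (J2 t) (\<lambda>s. exp (Re (- R s - - R t)) * k s)" if "t \<in> I" for t
    unfolding B_def using w2_eq[OF that] by (intro integral_cong) (simp add: ac_simps)
  have Sup_pos: "0 < (SUP t\<in>I. B t)"
  proof -
    obtain t where t: "\<tau> < ereal t" "ereal t < \<sigma>"
      using ereal_dense2[OF ends_less] by blast
    have "0 < integral (J2 t) (\<lambda>s. exp (Re (- R s - - R t)) * k s)"
      using cont_k contR R_int[OF mem_I[OF t]] k_nonneg k_pos t
      by (intro tail_integral_pos[OF J2]) (auto intro!: continuous_intros)
    also have "\<dots> \<le> (SUP t\<in>I. B t)"
      using B_le_Sup[OF mem_I[OF t]] B_eq[OF mem_I[OF t]] by simp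
    finally show ?thesis .
  qed
  have "\<exists>x x' x''. C2_with I x x' x'' \<and> (\<forall>t\<in>I. ode_op \<alpha> \<beta> \<gamma> x x' x'' t = f t) \<and>
      (\<forall>t\<in>I. N (\<xi> t - x t) \<le> (SUP t\<in>I. B t) * \<epsilon>)"
    if "\<epsilon> > 0" and \<xi>: "C2_with I \<xi> \<xi>' \<xi>''"
      and le: "\<And>t. t \<in> I \<Longrightarrow> N (ode_op \<alpha> \<beta> \<gamma> \<xi> \<xi>' \<xi>'' t - f t) \<le> \<epsilon>" for \<epsilon> \<xi> \<xi>' \<xi>''
  proof -
    have d\<xi>: "\<And>t. t \<in> I \<Longrightarrow> (\<xi> has_vector_derivative \<xi>' t) (at t within I)"
      and d\<xi>': "\<And>t. t \<in> I \<Longrightarrow> (\<xi>' has_vector_derivative \<xi>'' t) (at t within I)"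
      and c\<xi>'': "continuous_on I \<xi>''"
      using \<xi> by (auto simp: C2_with_def)
    define e where "e t = ode_op \<alpha> \<beta> \<gamma> \<xi> \<xi>' \<xi>'' t - f t" for t
    define h where "h t = (1 / \<alpha> t) *s e t" for t
    have "continuous_on I e"
      unfolding e_def ode_op_def
      using cont c\<xi>'' continuous_on_of_has_vector_derivative[OF d\<xi>]
        continuous_on_of_has_vector_derivative[OF d\<xi>']
      by (intro continuous_intros)
    then have cont_h: "continuous_on I h"
      unfolding h_def using cont(1) \<alpha> by (intro continuous_intros) auto
    have h_le: "N (h s) \<le> \<epsilon> * (1 / cmod (\<alpha> s))" if "s \<in> I" for s
    proof -
      have "N (h s) = N (e s) / cmod (\<alpha> s)"
        by (simp only: h_def cnorm_smult[OF N]) (simp add: norm_divide)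
      also have "\<dots> \<le> \<epsilon> / cmod (\<alpha> s)"
        using le[OF that] by (simp only: e_def divide_right_mono norm_ge_zero)
      finally show ?thesis by simp
    qed
    have P_int: "(\<lambda>s. exp (Re (P s - P t)) * (1 / cmod (\<alpha> s))) integrable_on J1 t" if "t \<in> I" for t
      using w1_eq[OF that] by (intro integrable_eq[OF w1_int[OF that]]) simp
    obtain z where z: "\<And>t. t \<in> I \<Longrightarrow>
          (z has_vector_derivative h t - (\<rho> t + \<beta> t / \<alpha> t) *s z t) (at t within I)"
      and z_le: "\<And>t. t \<in> I \<Longrightarrow>
          N (z t) \<le> \<epsilon> * integral (J1 t) (\<lambda>s. exp (Re (P s - P t)) * (1 / cmod (\<alpha> s)))"
      using first_order_tail_solution[OF J1 N cont_h P P_int h_le] by blast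
    \<comment> \<open>This is the input bound for the second equation, with constant
      \<open>\<epsilon>\<close> and profile \<open>k\<close>.\<close>
    have z_k: "N (z t) \<le> \<epsilon> * k t" if "t \<in> I" for t
    proof -
      have "integral (J1 t) (\<lambda>s. exp (Re (P s - P t)) * (1 / cmod (\<alpha> s))) = k t"
        unfolding k_def using w1_eq[OF that] by (intro integral_cong) simp
      with z_le[OF that] show ?thesis by simp
    qed
    have cont_z: "continuous_on I z"
      using z by (rule continuous_on_of_has_vector_derivative)
    obtain y where y: "\<And>t. t \<in> I \<Longrightarrow> (y has_vector_derivative z t - (- \<rho> t) *s y t) (at t within I)"
      and y_le: "\<And>t. t \<in> I \<Longrightarrow> N (y t) \<le> \<epsilon> * integral (J2 t) (\<lambda>s. exp (Re (- R s - - R t)) * k s)"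
      using first_order_tail_solution[OF J2 N cont_z has_vector_derivative_minus[OF R] R_int z_k]
      by blast
    define y' where "y' t = z t + \<rho> t *s y t" for t
    \<comment> \<open>The derivative of \<open>z + \<rho> y\<close> with the equation for
      \<open>z\<close> inserted; continuity of \<open>\<rho>'\<close> makes it continuous.\<close>
    define y'' where "y'' t = (h t - (\<rho> t + \<beta> t / \<alpha> t) *s z t) + (\<rho> t *s y' t + \<rho>' t *s y t)" for t
    have dy: "(y has_vector_derivative y' t) (at t within I)" if "t \<in> I" for t
      using y[OF that] by (simp add: y'_def vec_eq_iff)
    have dy': "(y' has_vector_derivative y'' t) (at t within I)" if "t \<in> I" for t
      unfolding y'_def[abs_def] y''_def
      using has_vector_derivative_add[OF z[OF that] has_vector_derivative_smult[OF \<rho>(1)[OF that] dy[OF that]]]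
      by (simp add: y'_def)
    have "continuous_on I y''"
      unfolding y''_def using cont_h cont_z cont\<rho> cont \<alpha> \<rho>(2)
        continuous_on_of_has_vector_derivative[OF dy] continuous_on_of_has_vector_derivative[OF dy']
      by (intro continuous_intros) auto
    then have "C2_with I (\<lambda>t. \<xi> t - y t) (\<lambda>t. \<xi>' t - y' t) (\<lambda>t. \<xi>'' t - y'' t)"
      unfolding C2_with_def using c\<xi>''
      by (auto intro!: has_vector_derivative_diff d\<xi> d\<xi>' dy dy' continuous_intros)
    moreover have "ode_op \<alpha> \<beta> \<gamma> (\<lambda>t. \<xi> t - y t) (\<lambda>t. \<xi>' t - y' t) (\<lambda>t. \<xi>'' t - y'' t) t = f t"
      if t: "t \<in> I" for t
    proof -
      \<comment> \<open>All terms in \<open>z\<close> cancel, and what multiplies \<open>y\<close>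
        is the left side of the Riccati equation.\<close>
      have "\<alpha> t *s y'' t + \<beta> t *s y' t + \<gamma> t *s y t
          = e t + (\<alpha> t * (\<rho>' t + (\<rho> t)\<^sup>2) + \<beta> t * \<rho> t + \<gamma> t) *s y t"
        using \<alpha>[OF t] by (simp add: y''_def y'_def h_def vec_eq_iff field_simps power2_eq_square)
      then have "\<alpha> t *s y'' t + \<beta> t *s y' t + \<gamma> t *s y t = e t"
        by (simp add: bspec[OF riccati t])
      then show ?thesis
        by (simp add: e_def ode_op_def vec_eq_iff algebra_simps)
    qed
    moreover have "N (\<xi> t - (\<xi> t - y t)) \<le> (SUP t\<in>I. B t) * \<epsilon>" if t: "t \<in> I" for t
    proof -
      have "N (y t) \<le> \<epsilon> * B t"
        using y_le[OF t] B_eq[OF t] by simp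
      also have "\<dots> \<le> \<epsilon> * (SUP t\<in>I. B t)"
        using B_le_Sup[OF t] \<open>\<epsilon> > 0\<close> by simp
      finally show ?thesis by (simp add: mult.commute)
    qed
    ultimately show ?thesis by blast
  qed
  with Sup_pos show ?thesis
    unfolding ulam_constant_def B_def k_def by blast
qed

end

section \<open>The three choices of ends of integration\<close>

theorem theorem3p1:
  fixes \<tau> \<sigma> :: ereal and I :: "real set" and N :: "complex^'n \<Rightarrow> real"
    and \<alpha> \<beta> \<gamma> \<rho> \<rho>' :: "real \<Rightarrow> complex" and f :: "real \<Rightarrow> complex^'n"
  assumes "\<tau> < \<sigma>"
    and "{x. \<tau> < ereal x \<and> ereal x < \<sigma>} \<subseteq> I" and "I \<subseteq> {x. \<tau> \<le> ereal x \<and> ereal x \<le> \<sigma>}"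
    and "is_cnorm N"
    and "continuous_on I \<alpha>" and "continuous_on I \<beta>" and "continuous_on I \<gamma>"
    and "\<forall>t\<in>I. \<alpha> t \<noteq> 0"
    and "continuous_on I f"
    and "\<forall>t\<in>I. (\<rho> has_vector_derivative \<rho>' t) (at t within I)" and "continuous_on I \<rho>'"
    and "\<forall>t\<in>I. \<alpha> t * (\<rho>' t + (\<rho> t)\<^sup>2) + \<beta> t * \<rho> t + \<gamma> t = 0"
  shows
    "((\<forall>t\<in>I. g1 \<alpha> \<beta> \<rho> t integrable_on to_right \<sigma> t) \<and> (\<forall>t\<in>I. g2 \<rho> t integrable_on to_right \<sigma> t)
       \<and> bdd_above (f1 \<alpha> \<beta> \<rho> \<sigma> ` I) \<and> bdd_above (f2 \<rho> \<sigma> ` I)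
      \<longrightarrow> ulam_stable N I \<alpha> \<beta> \<gamma> f \<and>
          ulam_constant N I \<alpha> \<beta> \<gamma> f
            (SUP t\<in>I. integral (to_right \<sigma> t) (\<lambda>s. f1 \<alpha> \<beta> \<rho> \<sigma> s * exp (- wR \<rho> t s))))
   \<and> ((\<forall>t\<in>I. g1 \<alpha> \<beta> \<rho> t integrable_on to_right \<sigma> t) \<and> (\<forall>t\<in>I. g3 \<rho> t integrable_on from_left \<tau> t)
       \<and> bdd_above (f1 \<alpha> \<beta> \<rho> \<sigma> ` I) \<and> bdd_above (f3 \<rho> \<tau> ` I)
      \<longrightarrow> ulam_stable N I \<alpha> \<beta> \<gamma> f \<and>
          ulam_constant N I \<alpha> \<beta> \<gamma> f
            (SUP t\<in>I. integral (from_left \<tau> t) (\<lambda>s. f1 \<alpha> \<beta> \<rho> \<sigma> s * exp (wR \<rho> s t))))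
   \<and> ((\<forall>t\<in>I. g3 \<rho> t integrable_on from_left \<tau> t) \<and> (\<forall>t\<in>I. g4 \<alpha> \<beta> \<rho> t integrable_on from_left \<tau> t)
       \<and> bdd_above (f3 \<rho> \<tau> ` I) \<and> bdd_above (f4 \<alpha> \<beta> \<rho> \<tau> ` I)
      \<longrightarrow> ulam_stable N I \<alpha> \<beta> \<gamma> f \<and>
          ulam_constant N I \<alpha> \<beta> \<gamma> f
            (SUP t\<in>I. integral (from_left \<tau> t) (\<lambda>s. f4 \<alpha> \<beta> \<rho> \<tau> s * exp (wR \<rho> s t))))"
proof -
  interpret ereal_interval \<tau> \<sigma> I
    using assms(1-3) by unfold_locales
  have cont\<rho>: "continuous_on I \<rho>"
    using assms(10) by (intro continuous_on_of_has_vector_derivative) blast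
  have contp: "continuous_on I (\<lambda>t. \<rho> t + \<beta> t / \<alpha> t)"
    using cont\<rho> assms(5,6,8) by (intro continuous_intros) auto
  \<comment> \<open>The exponents integrate real parts, whereas \<open>P\<close> and
    \<open>R\<close> are complex primitives.\<close>
  have Re_integral: "integral {a..b} (\<lambda>t. Re (q t)) = Re (integral {a..b} q)"
    if "a \<in> I" "b \<in> I" "continuous_on I q" for a b q
  proof -
    have "{a..b} \<subseteq> I"
      using mem_is_interval_1_I[OF is_interval_I that(1,2)] by auto
    then have "q integrable_on {a..b}"
      by (intro integrable_continuous_real continuous_on_subset[OF that(3)])
    from integral_linear[OF this bounded_linear_Re] show ?thesis
      by (simp add: o_def)
  qed
  obtain P where P: "\<And>t. t \<in> I \<Longrightarrow> (P has_vector_derivative \<rho> t + \<beta> t / \<alpha> t) (at t within I)"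
    and P_incr: "\<And>a b. a \<in> I \<Longrightarrow> b \<in> I \<Longrightarrow> a \<le> b \<Longrightarrow>
      P b - P a = integral {a..b} (\<lambda>t. \<rho> t + \<beta> t / \<alpha> t)"
    by (rule continuous_on_antiderivative[OF is_interval_I contp]) (rule that, assumption+)
  obtain R where R: "\<And>t. t \<in> I \<Longrightarrow> (R has_vector_derivative \<rho> t) (at t within I)"
    and R_incr: "\<And>a b. a \<in> I \<Longrightarrow> b \<in> I \<Longrightarrow> a \<le> b \<Longrightarrow> R b - R a = integral {a..b} \<rho>"
    by (rule continuous_on_antiderivative[OF is_interval_I cont\<rho>]) (rule that, assumption+)
  have wA: "wA \<alpha> \<beta> \<rho> a b = Re (P b - P a)" if "a \<in> I" "b \<in> I" "a \<le> b" for a b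
    using that by (simp only: wA_def Re_integral[OF _ _ contp] P_incr)
  have wR: "wR \<rho> a b = Re (R b - R a)" if "a \<in> I" "b \<in> I" "a \<le> b" for a b
    using that by (simp only: wR_def Re_integral[OF _ _ cont\<rho>] R_incr)
  have right: "tail (to_right \<sigma>) (-1)" and left: "tail (from_left \<tau>) 1"
    by (simp_all add: tail_def)
  have in_right: "s \<in> I" "t \<le> s" if "t \<in> I" "s \<in> to_right \<sigma> t" for s t
    using tail_subset[OF right that(1)] that(2) by (auto simp: to_right_def)
  have in_left: "s \<in> I" "s \<le> t" if "t \<in> I" "s \<in> from_left \<tau> t" for s t
    using tail_subset[OF left that(1)] that(2) by (auto simp: from_left_def)
  \<comment> \<open>In \<open>g4\<close> both the sign and the order of the limits are reversed
    relative to \<open>g1\<close>, so both reduce to one expression in \<open>P\<close>;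
    \<open>g2\<close> and \<open>g3\<close> coincide likewise in \<open>R\<close>.\<close>
  have g1: "g1 \<alpha> \<beta> \<rho> t s = exp (Re (P s - P t)) / cmod (\<alpha> s)" if "t \<in> I" "s \<in> to_right \<sigma> t" for t s
    using wA[OF that(1) in_right[OF that]] by (simp add: g1_def)
  have g4: "g4 \<alpha> \<beta> \<rho> t s = exp (Re (P s - P t)) / cmod (\<alpha> s)" if "t \<in> I" "s \<in> from_left \<tau> t" for t s
    using wA[OF in_left(1)[OF that] that(1) in_left(2)[OF that]] by (simp add: g4_def)
  have g2: "g2 \<rho> t s = exp (Re (R t - R s))" if "t \<in> I" "s \<in> to_right \<sigma> t" for t s
    using wR[OF that(1) in_right[OF that]] by (simp add: g2_def)
  have g3: "g3 \<rho> t s = exp (Re (R t - R s))" if "t \<in> I" "s \<in> from_left \<tau> t" for t s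
    using wR[OF in_left(1)[OF that] that(1) in_left(2)[OF that]] by (simp add: g3_def)
  have PR: "\<forall>t\<in>I. (P has_vector_derivative \<rho> t + \<beta> t / \<alpha> t) (at t within I)"
    "\<forall>t\<in>I. (R has_vector_derivative \<rho> t) (at t within I)"
    using P R by simp_all
  note ulam = ulam_constant_tails[where \<alpha> = \<alpha> and \<beta> = \<beta> and \<gamma> = \<gamma> and f = f and N = N,
      OF assms(4-7,9,8,10-12) PR]
  \<comment> \<open>Both equations are integrated to the right here; next the first goes right and
    the second left, and in the last case both go left.\<close>
  have i: "ulam_constant N I \<alpha> \<beta> \<gamma> f
      (SUP t\<in>I. integral (to_right \<sigma> t) (\<lambda>s. f1 \<alpha> \<beta> \<rho> \<sigma> s * exp (- wR \<rho> t s)))"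
    if "\<forall>t\<in>I. g1 \<alpha> \<beta> \<rho> t integrable_on to_right \<sigma> t" "\<forall>t\<in>I. g2 \<rho> t integrable_on to_right \<sigma> t"
      "bdd_above (f1 \<alpha> \<beta> \<rho> \<sigma> ` I)" "bdd_above (f2 \<rho> \<sigma> ` I)"
    using ulam[OF right right g1 g2 bspec[OF that(1)] bspec[OF that(2)]] that(3,4)
    unfolding f1_def[abs_def] f2_def[abs_def] g2_def by blast
  have ii: "ulam_constant N I \<alpha> \<beta> \<gamma> f
      (SUP t\<in>I. integral (from_left \<tau> t) (\<lambda>s. f1 \<alpha> \<beta> \<rho> \<sigma> s * exp (wR \<rho> s t)))"
    if "\<forall>t\<in>I. g1 \<alpha> \<beta> \<rho> t integrable_on to_right \<sigma> t" "\<forall>t\<in>I. g3 \<rho> t integrable_on from_left \<tau> t"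
      "bdd_above (f1 \<alpha> \<beta> \<rho> \<sigma> ` I)" "bdd_above (f3 \<rho> \<tau> ` I)"
    using ulam[OF right left g1 g3 bspec[OF that(1)] bspec[OF that(2)]] that(3,4)
    unfolding f1_def[abs_def] f3_def[abs_def] g3_def by blast
  have iii: "ulam_constant N I \<alpha> \<beta> \<gamma> f
      (SUP t\<in>I. integral (from_left \<tau> t) (\<lambda>s. f4 \<alpha> \<beta> \<rho> \<tau> s * exp (wR \<rho> s t)))"
    if "\<forall>t\<in>I. g3 \<rho> t integrable_on from_left \<tau> t" "\<forall>t\<in>I. g4 \<alpha> \<beta> \<rho> t integrable_on from_left \<tau> t"
      "bdd_above (f3 \<rho> \<tau> ` I)" "bdd_above (f4 \<alpha> \<beta> \<rho> \<tau> ` I)"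
    using ulam[OF left left g4 g3 bspec[OF that(2)] bspec[OF that(1)]] that(3,4)
    unfolding f4_def[abs_def] f3_def[abs_def] g3_def by blast
  have stable: "ulam_stable N I \<alpha> \<beta> \<gamma> f" if "ulam_constant N I \<alpha> \<beta> \<gamma> f L" for L
    using that by (auto simp: ulam_stable_def)
  show ?thesis
    by (intro conjI impI; elim conjE; (rule stable)?; rule i ii iii; assumption)
qed

end
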